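(* Let $(x_k)_{k\ge0}$ be generated by algorithm CPG or CGD (see context) under the assumptions stated there, with $i_k$ chosen uniformly at random. Assume that for some constant $C>0$, $$F(x_k)-\mathbb{E}[F(x_{k+1})\mid x_k]\ge C\|\nabla F(x_k)\|^2\qquad\forall k\ge0,$$ that $F$ is convex, and that $R<\infty$, where $R=\max_{k\ge0}\min_{x^*\in X^*}\|x_k-x^*\|$ and $X^*$ is the set of minimizers of $F$. Then for all $k\ge0$ and $x^*\in X^*$, $$\mathbb{E}[F(x_k)-F(x^* )]\le\frac{(F(x_0)-F(x^* ))\,R^2}{C\,(F(x_0)-F(x^* ))\,k+R^2}.$$
   Context: Setting: $F=f+\psi$ with $f,\psi:\mathbb{R}^n\to\mathbb{R}$, $f$ differentiable ($f$ and $\psi$ need not be separately convex). $U=[U_1,\dots,U_N]\in\mathbb{R}^{n\times n}$ is a column permutation of $I_n$, split into $U_i\in\mathbb{R}^{n\times n_i}$, $\sum_i n_i=n$. Norms are Euclidean / induced operator norms. The $i_k$ are independent, each uniform on $\{1,\dots,N\}$ and independent of the past; $x_0$ is deterministic. $R$ is a deterministic constant: the maximum (supremum) is taken over all $k$ and all realizations of the iterates. Assumptions. A.1: $\|U_i^T(\nabla f(x+U_ih)-\nabla f(x))\|\le L_i\|h\|$ for all $h,x,i$. A.2: $\psi$ is twice continuously differentiable. A.3: $F$ attains its minimum $F^*>-\infty$. Algorithm CPG: fix $\eta_i>0$; $H_{f,U_i}=\frac{L_i+\eta_i}{2}$ if $d\mapsto\psi(x+U_id)$ is convex for all $x,i$,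 else $H_{f,U_i}=L_i+\eta_i$. Given $x_0$, for $k\ge0$: choose $i_k$; take $d_k\in\arg\min_{d\in\mathbb{R}^{n_{i_k}}}f(x_k)+\langle U_{i_k}^T\nabla f(x_k),d\rangle+\frac{H_{f,U_{i_k}}}{2}\|d\|^2+\psi(x_k+U_{i_k}d)$ (assumed to exist); $x_{k+1}=x_k+U_{i_k}d_k$. Algorithm CGD: fix $\eta_i>0$; $H_{f,U_i}=\frac{L_i+\eta_i}{2}$. Given $x_0$, for $k\ge0$: choose $i_k$, compute $H_{F_k}$ by one of the rules below, $d_k=-\frac1{H_{F_k}}U_{i_k}^T\nabla F(x_k)$, $x_{k+1}=x_k+U_{i_k}d_k$. The same rule is used for all $k$, and $\psi$ satisfies the assumption attached to it: Rule 1 (A.4 and A.5): $\alpha_k\ge0$ root of $\frac{L_\psi}{6}\alpha^2+(\frac{H_\psi}{2}\|x_k\|^p+H_{f,U_{i_k}})\alpha=\|U_{i_k}^T\nabla F(x_k)\|$; $H_{F_k}=\frac{H_\psi}{2}\|x_k\|^p+\frac{L_\psi}{6}\alpha_k+H_{f,U_{i_k}}$. Rule 2 (A.4): $\alpha_k\ge0$ root of $2^{p-1}H_\psi\alpha^{p+1}+(2^{p-1}H_\psi\|x_k\|^p+H_{f,U_{i_k}})\alpha=\|U_{i_k}^T\nabla F(x_k)\|$; $H_{F_k}=2^{p-1}H_\psi\|x_k\|^p+2^{p-1}H_\psi\alpha_k^p+H_{f,U_{i_k}}$. Rule 3 (A.5): $\alpha_k\ge0$ root of $\frac{L_\psi}{6}\alpha^2+(\frac{L_\psi}{2}\|x_k-x_0\|+\frac12\|\nabla^2\psi(x_0)\|+H_{f,U_{i_k}})\alpha=\|U_{i_k}^T\nabla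 F(x_k)\|$; $H_{F_k}=\frac{L_\psi}{2}\|x_k-x_0\|+\frac12\|\nabla^2\psi(x_0)\|+\frac{L_\psi}{6}\alpha_k+H_{f,U_{i_k}}$. Rule 4 (A.6): $H_{F_k}=H_{f,U_{i_k}}$. Here A.4: $\|U_i^T\nabla^2\psi(y)U_i\|\le H_\psi\|y\|^p$ for all $y,i$ ($H_\psi>0$, integer $p\ge1$); A.5: $\|\nabla^2\psi(y)-\nabla^2\psi(x)\|\le L_\psi\|y-x\|$ for all $x,y$ ($L_\psi>0$); A.6: $\psi(x+U_id)\le\psi(x)+\langle U_i^T\nabla\psi(x),d\rangle$ for all $x,d,i$. *)

theory Defs
  imports "HOL-Probability.Probability"
begin

section \<open>Gradients, Hessians, minimizers\<close>

definition grad :: "(real^'n \<Rightarrow> real) \<Rightarrow> real^'n \<Rightarrow> real^'n" where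
  "grad g x = (THE v. GDERIV g x :> v)"

definition hess :: "(real^'n \<Rightarrow> real) \<Rightarrow> real^'n \<Rightarrow> real^'n^'n" where
  "hess g x = matrix (frechet_derivative (grad g) (at x))"

definition twice_cont_diff :: "(real^'n \<Rightarrow> real) \<Rightarrow> bool" where
  "twice_cont_diff g \<longleftrightarrow>
     (\<forall>x. g differentiable (at x)) \<and> (\<forall>x. grad g differentiable (at x)) \<and>
     continuous_on UNIV (hess g)"

definition mnorm :: "real^'n^'n \<Rightarrow> real" where
  "mnorm A = onorm ((*v) A)"

definition minimizers :: "(real^'n \<Rightarrow> real) \<Rightarrow> (real^'n) set" where
  "minimizers g = {x. is_arg_min g (\<lambda>_. True) x}"


section \<open>Block decomposition\<close>

text \<open>
  The block sizes \<open>n\<^sub>i\<close> vary with \<open>i\<close>, so they cannot be index types. The columns of the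
  \<open>n \<times> n\<close> matrix \<open>U\<close> are split into the column index sets \<open>B 1, \<dots>, B N\<close>, with
  \<open>n\<^sub>i = card (B i)\<close>. The space of dimension \<open>n\<^sub>i\<close> is represented by the vectors indexed by
  \<open>B i\<close>, padded with zeros to all of \<open>'n\<close> (\<open>block_space\<close>), and the block \<open>U\<^sub>i\<close> by the matrix
  with the columns of \<open>U\<close> at \<open>B i\<close> and zero columns elsewhere (\<open>blk\<close>). Matrix products,
  inner products, Euclidean norms and operator norms are unaffected by the padding, and
  \<open>transpose (blk U B i) *v v\<close> lies in \<open>block_space B i\<close> for every \<open>v\<close>.
  The index type is unordered, so the blocks need not be contiguous.
\<close>

definition column_permutation :: "real^'n^'n \<Rightarrow> bool" where
  "column_permutation U \<longleftrightarrow> (\<exists>\<pi>. bij \<pi> \<and> (\<forall>c. column c U = column (\<pi> c) (mat 1)))"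

definition block_split :: "nat \<Rightarrow> (nat \<Rightarrow> 'n set) \<Rightarrow> bool" where
  "block_split N B \<longleftrightarrow> disjoint_family_on B {1..N} \<and> (\<Union>i\<in>{1..N}. B i) = UNIV"

definition block_space :: "(nat \<Rightarrow> 'n set) \<Rightarrow> nat \<Rightarrow> (real^'n) set" where
  "block_space B i = {d. \<forall>c. c \<notin> B i \<longrightarrow> d $ c = 0}"

definition blk :: "real^'n^'n \<Rightarrow> (nat \<Rightarrow> 'n set) \<Rightarrow> nat \<Rightarrow> real^'n^'n" where
  "blk U B i = (\<chi> r c. if c \<in> B i then U $ r $ c else 0)"


section \<open>Assumptions\<close>

definition block_lipschitz_grad ::
  "(real^'n \<Rightarrow> real) \<Rightarrow> real^'n^'n \<Rightarrow> nat \<Rightarrow> (nat \<Rightarrow> 'n set) \<Rightarrow> (nat \<Rightarrow> real) \<Rightarrow> bool" where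
  "block_lipschitz_grad f U N B L \<longleftrightarrow>
     (\<forall>i\<in>{1..N}. \<forall>x. \<forall>h\<in>block_space B i.
        norm (transpose (blk U B i) *v (grad f (x + blk U B i *v h) - grad f x)) \<le> L i * norm h)"

definition block_hess_growth ::
  "(real^'n \<Rightarrow> real) \<Rightarrow> real^'n^'n \<Rightarrow> nat \<Rightarrow> (nat \<Rightarrow> 'n set) \<Rightarrow> real \<Rightarrow> nat \<Rightarrow> bool" where
  "block_hess_growth \<psi> U N B H\<psi> p \<longleftrightarrow> H\<psi> > 0 \<and> p \<ge> 1 \<and>
     (\<forall>i\<in>{1..N}. \<forall>y. mnorm (transpose (blk U B i) ** hess \<psi> y ** blk U B i) \<le> H\<psi> * norm y ^ p)"

definition lipschitz_hess :: "(real^'n \<Rightarrow> real) \<Rightarrow> real \<Rightarrow> bool" where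
  "lipschitz_hess \<psi> L\<psi> \<longleftrightarrow> L\<psi> > 0 \<and>
     (\<forall>x y. mnorm (hess \<psi> y - hess \<psi> x) \<le> L\<psi> * norm (y - x))"

definition block_linear_upper ::
  "(real^'n \<Rightarrow> real) \<Rightarrow> real^'n^'n \<Rightarrow> nat \<Rightarrow> (nat \<Rightarrow> 'n set) \<Rightarrow> bool" where
  "block_linear_upper \<psi> U N B \<longleftrightarrow>
     (\<forall>i\<in>{1..N}. \<forall>x. \<forall>d\<in>block_space B i.
        \<psi> (x + blk U B i *v d) \<le> \<psi> x + (transpose (blk U B i) *v grad \<psi> x) \<bullet> d)"


section \<open>Algorithm CPG\<close>

text \<open>
  The two run predicates concern one realization: \<open>i\<close> is the sequence of chosen
  blocks and \<open>x\<close> the sequence of iterates. The step \<open>d\<^sub>k\<close> is determined by \<open>x\<close> and \<open>i\<close>, and is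
  therefore existentially quantified.
\<close>

text \<open>The convexity condition in \<open>H_cpg\<close> is global: it does not depend on the block \<open>i\<close>.\<close>

definition H_cpg ::
  "(real^'n \<Rightarrow> real) \<Rightarrow> real^'n^'n \<Rightarrow> nat \<Rightarrow> (nat \<Rightarrow> 'n set) \<Rightarrow> (nat \<Rightarrow> real) \<Rightarrow> (nat \<Rightarrow> real) \<Rightarrow>
   nat \<Rightarrow> real" where
  "H_cpg \<psi> U N B L \<eta> i =
     (if \<forall>j\<in>{1..N}. \<forall>x. convex_on (block_space B j) (\<lambda>d. \<psi> (x + blk U B j *v d))
      then (L i + \<eta> i) / 2 else L i + \<eta> i)"

definition cpg_run ::
  "(real^'n \<Rightarrow> real) \<Rightarrow> (real^'n \<Rightarrow> real) \<Rightarrow> real^'n^'n \<Rightarrow> nat \<Rightarrow> (nat \<Rightarrow> 'n set) \<Rightarrow>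
   (nat \<Rightarrow> real) \<Rightarrow> (nat \<Rightarrow> real) \<Rightarrow> real^'n \<Rightarrow> (nat \<Rightarrow> nat) \<Rightarrow> (nat \<Rightarrow> real^'n) \<Rightarrow> bool" where
  "cpg_run f \<psi> U N B L \<eta> x0 i x \<longleftrightarrow> x 0 = x0 \<and>
     (\<forall>k. i k \<in> {1..N} \<and>
       (\<exists>d. is_arg_min
              (\<lambda>d. f (x k) + (transpose (blk U B (i k)) *v grad f (x k)) \<bullet> d
                   + H_cpg \<psi> U N B L \<eta> (i k) / 2 * (norm d)\<^sup>2
                   + \<psi> (x k + blk U B (i k) *v d))
              (\<lambda>d. d \<in> block_space B (i k)) d
          \<and> x (Suc k) = x k + blk U B (i k) *v d))"


section \<open>Algorithm CGD\<close>

text \<open>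
  In the rules below, \<open>xk\<close> is the current iterate, \<open>Hf\<close> the constant of the chosen block for \<open>f\<close>,
  \<open>g\<close> the norm of the block gradient of the objective, and \<open>HF\<close> the resulting value.
\<close>

definition rule1 :: "real \<Rightarrow> nat \<Rightarrow> real \<Rightarrow> real^'n \<Rightarrow> real \<Rightarrow> real \<Rightarrow> real \<Rightarrow> bool" where
  "rule1 H\<psi> p L\<psi> xk Hf g HF \<longleftrightarrow> (\<exists>\<alpha>\<ge>0.
     L\<psi> / 6 * \<alpha>\<^sup>2 + (H\<psi> / 2 * norm xk ^ p + Hf) * \<alpha> = g \<and>
     HF = H\<psi> / 2 * norm xk ^ p + L\<psi> / 6 * \<alpha> + Hf)"

definition rule2 :: "real \<Rightarrow> nat \<Rightarrow> real^'n \<Rightarrow> real \<Rightarrow> real \<Rightarrow> real \<Rightarrow> bool" where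
  "rule2 H\<psi> p xk Hf g HF \<longleftrightarrow> (\<exists>\<alpha>\<ge>0.
     2 ^ (p - 1) * H\<psi> * \<alpha> ^ (p + 1) + (2 ^ (p - 1) * H\<psi> * norm xk ^ p + Hf) * \<alpha> = g \<and>
     HF = 2 ^ (p - 1) * H\<psi> * norm xk ^ p + 2 ^ (p - 1) * H\<psi> * \<alpha> ^ p + Hf)"

definition rule3 ::
  "(real^'n \<Rightarrow> real) \<Rightarrow> real^'n \<Rightarrow> real \<Rightarrow> real^'n \<Rightarrow> real \<Rightarrow> real \<Rightarrow> real \<Rightarrow> bool" where
  "rule3 \<psi> x0 L\<psi> xk Hf g HF \<longleftrightarrow> (\<exists>\<alpha>\<ge>0.
     L\<psi> / 6 * \<alpha>\<^sup>2 + (L\<psi> / 2 * norm (xk - x0) + 1 / 2 * mnorm (hess \<psi> x0) + Hf) * \<alpha> = g \<and>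
     HF = L\<psi> / 2 * norm (xk - x0) + 1 / 2 * mnorm (hess \<psi> x0) + L\<psi> / 6 * \<alpha> + Hf)"

definition rule4 :: "real^'n \<Rightarrow> real \<Rightarrow> real \<Rightarrow> real \<Rightarrow> bool" where
  "rule4 xk Hf g HF \<longleftrightarrow> HF = Hf"

definition admissible_rule ::
  "(real^'n \<Rightarrow> real) \<Rightarrow> real^'n^'n \<Rightarrow> nat \<Rightarrow> (nat \<Rightarrow> 'n set) \<Rightarrow> real^'n \<Rightarrow> real \<Rightarrow> nat \<Rightarrow> real \<Rightarrow>
   (real^'n \<Rightarrow> real \<Rightarrow> real \<Rightarrow> real \<Rightarrow> bool) \<Rightarrow> bool" where
  "admissible_rule \<psi> U N B x0 H\<psi> p L\<psi> rl \<longleftrightarrow>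
     (block_hess_growth \<psi> U N B H\<psi> p \<and> lipschitz_hess \<psi> L\<psi> \<and> rl = rule1 H\<psi> p L\<psi>) \<or>
     (block_hess_growth \<psi> U N B H\<psi> p \<and> rl = rule2 H\<psi> p) \<or>
     (lipschitz_hess \<psi> L\<psi> \<and> rl = rule3 \<psi> x0 L\<psi>) \<or>
     (block_linear_upper \<psi> U N B \<and> rl = rule4)"

definition cgd_run ::
  "(real^'n \<Rightarrow> real) \<Rightarrow> real^'n^'n \<Rightarrow> nat \<Rightarrow> (nat \<Rightarrow> 'n set) \<Rightarrow> (nat \<Rightarrow> real) \<Rightarrow> (nat \<Rightarrow> real) \<Rightarrow>
   (real^'n \<Rightarrow> real \<Rightarrow> real \<Rightarrow> real \<Rightarrow> bool) \<Rightarrow> real^'n \<Rightarrow> (nat \<Rightarrow> nat) \<Rightarrow> (nat \<Rightarrow> real^'n) \<Rightarrow> bool" where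
  "cgd_run F U N B L \<eta> rl x0 i x \<longleftrightarrow> x 0 = x0 \<and>
     (\<forall>k. i k \<in> {1..N} \<and>
       (\<exists>HF d. rl (x k) ((L (i k) + \<eta> (i k)) / 2)
                 (norm (transpose (blk U B (i k)) *v grad F (x k))) HF
             \<and> d = - (1 / HF) *\<^sub>R (transpose (blk U B (i k)) *v grad F (x k))
             \<and> x (Suc k) = x k + blk U B (i k) *v d))"


section \<open>Random choice of the blocks\<close>

text \<open>
  The past at step \<open>k\<close> consists of \<open>i\<^sub>0, \<dots>, i\<^sub>k\<^sub>-\<^sub>1\<close> and \<open>x\<^sub>0, \<dots>, x\<^sub>k\<close>.
  It is not required to be generated by the \<open>i\<^sub>j\<close> alone, so the choice of an element of a
  non-unique arg min may use extra randomness.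
\<close>

definition uniform_block_choice ::
  "'w measure \<Rightarrow> nat \<Rightarrow> (nat \<Rightarrow> 'w \<Rightarrow> nat) \<Rightarrow> (nat \<Rightarrow> 'w \<Rightarrow> real^'n) \<Rightarrow> bool" where
  "uniform_block_choice M N i x \<longleftrightarrow>
     prob_space.indep_vars M (\<lambda>_. count_space UNIV) i UNIV \<and>
     (\<forall>k. distr M (count_space UNIV) (i k) = measure_pmf (pmf_of_set {1..N})) \<and>
     (\<forall>k. prob_space.indep_set M
            (sets (vimage_algebra (space M) (i k) (count_space UNIV)))
            (sets (vimage_algebra (space M) (\<lambda>\<omega>. (\<lambda>j\<in>{..<k}. i j \<omega>, \<lambda>j\<in>{..k}. x j \<omega>))
              (PiM {..<k} (\<lambda>_. count_space UNIV) \<Otimes>\<^sub>M PiM {..k} (\<lambda>_. borel)))))"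

definition cond_exp_given :: "'w measure \<Rightarrow> ('w \<Rightarrow> real) \<Rightarrow> ('w \<Rightarrow> real^'n) \<Rightarrow> 'w \<Rightarrow> real" where
  "cond_exp_given M Y X = real_cond_exp M (vimage_algebra (space M) X borel) Y"

end

theory Submission
  imports Defs
begin

text \<open>
  If \<open>\<delta>\<^sub>k = E[F(x\<^sub>k)] - F\<^sup>*\<close>, convexity and the definition of \<open>R\<close> give
  \<open>F(x\<^sub>k) - F\<^sup>* \<le> R \<parallel>\<nabla>F(x\<^sub>k)\<parallel>\<close>, so the assumed decrease and Jensen's inequality yield
  \<open>\<delta>\<^sub>k\<^sub>+\<^sub>1 \<le> \<delta>\<^sub>k - (C / R\<^sup>2) \<delta>\<^sub>k\<^sup>2\<close>, which integrates to the rate. The algorithm itself matters only for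
  integrability of \<open>F(x\<^sub>k)\<close>: a CPG step never increases \<open>F\<close>, and a CGD step is determined by the
  chosen block, so that \<open>x\<^sub>k\<close> takes finitely many values.
\<close>

section \<open>Gradients and convexity\<close>

text \<open>\<open>grad\<close> is a definite description, so existence and uniqueness are both due:
  the values of the derivative on the basis assemble to a gradient vector, and testing two
  candidates on their difference shows that they agree.\<close>

lemma GDERIV_grad:
  fixes g :: "real^'n \<Rightarrow> real"
  assumes "g differentiable (at x)"
  shows "GDERIV g x :> grad g x"
proof -
  obtain D where D: "(g has_derivative D) (at x)"
    using assms by (auto simp: differentiable_def)
  then interpret bounded_linear D by (rule has_derivative_bounded_linear)
  define v where "v = (\<Sum>b\<in>Basis. D b *\<^sub>R b)"
  have "D = (\<lambda>h. h \<bullet> v)"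
  proof
    fix h
    have "D h = D (\<Sum>b\<in>Basis. (h \<bullet> b) *\<^sub>R b)"
      by (simp add: euclidean_representation)
    also have "\<dots> = h \<bullet> v"
      by (simp add: sum scaleR v_def inner_sum_right mult.commute)
    finally show "D h = h \<bullet> v" .
  qed
  then have v: "GDERIV g x :> v"
    using D by (simp add: gderiv_def)
  moreover have "w = v" if "GDERIV g x :> w" for w
  proof -
    have "(\<lambda>h. h \<bullet> w) = (\<lambda>h. h \<bullet> v)"
      using that v has_derivative_unique unfolding gderiv_def by blast
    then have "(w - v) \<bullet> (w - v) = 0"
      by (metis inner_diff_right right_minus_eq)
    then show ?thesis by simp
  qed
  ultimately show ?thesis
    unfolding grad_def by (rule theI)
qed

text \<open>Reduces to one real variable: both the gradient inequality for convex functions and the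
  block descent bound are proved along a line.\<close>

lemma DERIV_along_line:
  fixes g :: "real^'n \<Rightarrow> real"
  assumes "\<And>y. g differentiable (at y)"
  shows "((\<lambda>t. g (x + t *\<^sub>R v)) has_real_derivative (grad g (x + t *\<^sub>R v) \<bullet> v)) (at t)"
proof -
  have "(g has_derivative (\<lambda>h. h \<bullet> grad g (x + t *\<^sub>R v))) (at (x + t *\<^sub>R v))"
    using GDERIV_grad[OF assms] by (simp add: gderiv_def)
  moreover have "((\<lambda>t. x + t *\<^sub>R v) has_derivative (\<lambda>s. s *\<^sub>R v)) (at t)"
    by (auto intro!: derivative_eq_intros)
  ultimately have "((\<lambda>t. g (x + t *\<^sub>R v)) has_derivative
      (\<lambda>s. (s *\<^sub>R v) \<bullet> grad g (x + t *\<^sub>R v))) (at t)"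
    by (rule has_derivative_compose[rotated])
  then show ?thesis
    by (simp add: has_field_derivative_def inner_commute mult_commute_abs)
qed

text \<open>On the line through \<open>x\<close> and \<open>y\<close> the function is convex in the
  parameter; its tangent at 0, evaluated at 1, gives the bound.\<close>

lemma convex_grad_ineq:
  fixes g :: "real^'n \<Rightarrow> real"
  assumes cvx: "convex_on UNIV g" and diff: "\<And>y. g differentiable (at y)"
  shows "g x - g y \<le> grad g x \<bullet> (x - y)"
proof -
  have "convex_on UNIV (\<lambda>t. g (x + t *\<^sub>R (y - x)))"
  proof (intro convex_onI)
    fix t a b :: real assume t: "0 < t" "t < 1"
    have eq: "x + ((1 - t) *\<^sub>R a + t *\<^sub>R b) *\<^sub>R (y - x)
        = (1 - t) *\<^sub>R (x + a *\<^sub>R (y - x)) + t *\<^sub>R (x + b *\<^sub>R (y - x))"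
      by (simp add: algebra_simps)
    show "g (x + ((1 - t) *\<^sub>R a + t *\<^sub>R b) *\<^sub>R (y - x))
        \<le> (1 - t) * g (x + a *\<^sub>R (y - x)) + t * g (x + b *\<^sub>R (y - x))"
      unfolding eq using convex_onD[OF cvx, of t] t by simp
  qed simp
  from convex_on_imp_above_tangent[OF this connected_UNIV, of 0 1]
  have "g y - g x \<ge> grad g x \<bullet> (y - x)"
    using DERIV_along_line[OF diff, where x=x and t=0 and v="y - x"] by simp
  then show ?thesis by (simp add: inner_diff_right)
qed

section \<open>Descent of the proximal steps\<close>

text \<open>The usual descent lemma, without integration: the block Lipschitz bound at the increment
  \<open>t *\<^sub>R d\<close> controls the derivative along the segment, and monotonicity does the
  rest.\<close>

lemma block_descent:
  fixes f :: "real^'n \<Rightarrow> real"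
  assumes diff: "\<And>y. f differentiable (at y)"
    and A1: "block_lipschitz_grad f U N B L" and j: "j \<in> {1..N}" and d: "d \<in> block_space B j"
  shows "f (x + blk U B j *v d)
    \<le> f x + (transpose (blk U B j) *v grad f x) \<bullet> d + L j / 2 * (norm d)\<^sup>2"
proof -
  define A where "A = blk U B j"
  \<comment> \<open>\<open>\<phi>\<close> is \<open>f\<close> along the segment minus the linear and
    quadratic terms of the model, so that the claim reads
    \<open>\<phi> 1 \<le> \<phi> 0\<close>.\<close>
  define \<phi> where "\<phi> t = f (x + t *\<^sub>R (A *v d)) - t * (grad f x \<bullet> (A *v d))
      - L j / 2 * t\<^sup>2 * (norm d)\<^sup>2" for t
  have deriv: "(\<phi> has_real_derivative (grad f (x + t *\<^sub>R (A *v d)) \<bullet> (A *v d)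
      - grad f x \<bullet> (A *v d) - L j * t * (norm d)\<^sup>2)) (at t)" for t
    unfolding \<phi>_def
    by (rule derivative_eq_intros DERIV_along_line diff refl | simp)+
  have nonpos: "grad f (x + t *\<^sub>R (A *v d)) \<bullet> (A *v d) - grad f x \<bullet> (A *v d)
      - L j * t * (norm d)\<^sup>2 \<le> 0" if "0 \<le> t" for t
  proof -
    have td: "t *\<^sub>R d \<in> block_space B j"
      using d by (simp add: block_space_def)
    have "grad f (x + t *\<^sub>R (A *v d)) \<bullet> (A *v d) - grad f x \<bullet> (A *v d)
        = (transpose A *v (grad f (x + A *v (t *\<^sub>R d)) - grad f x)) \<bullet> d"
      by (simp add: dot_lmul_matrix inner_diff_left matrix_vector_mult_scaleR)
    also have "\<dots> \<le> norm (transpose A *v (grad f (x + A *v (t *\<^sub>R d)) - grad f x)) * norm d"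
      by (rule norm_cauchy_schwarz)
    also have "\<dots> \<le> L j * norm (t *\<^sub>R d) * norm d"
      using A1 j td unfolding block_lipschitz_grad_def A_def
      by (blast intro: mult_right_mono norm_ge_zero)
    also have "\<dots> = L j * t * (norm d)\<^sup>2"
      using that by (simp add: power2_eq_square)
    finally show ?thesis by simp
  qed
  have "\<phi> 1 \<le> \<phi> 0"
  proof (rule DERIV_nonpos_imp_nonincreasing[of 0 1 \<phi>])
    show "\<exists>y. (\<phi> has_real_derivative y) (at t) \<and> y \<le> 0" if "0 \<le> t" for t
      by (rule exI, rule conjI, rule deriv, rule nonpos, rule that)
  qed simp
  then show ?thesis
    by (simp add: \<phi>_def A_def dot_lmul_matrix)
qed

text \<open>A unit vector of the block, taken as increment in the Lipschitz bound, forces the sign.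
  An empty block admits only the zero increment and leaves the sign of \<open>L j\<close> open;
  there \<open>blk_empty\<close> makes every step zero.\<close>

lemma block_lipschitz_nonneg:
  fixes B :: "nat \<Rightarrow> 'n::finite set"
  assumes A1: "block_lipschitz_grad f U N B L" and j: "j \<in> {1..N}" and B: "B j \<noteq> {}"
  shows "0 \<le> L j"
proof -
  obtain c where c: "c \<in> B j" using B by auto
  then have "axis c 1 \<in> block_space B j"
    by (auto simp: block_space_def axis_def)
  then have "norm (transpose (blk U B j) *v (grad f (0 + blk U B j *v axis c 1) - grad f 0))
      \<le> L j * norm (axis c (1::real) :: real^'n)"
    using A1 j unfolding block_lipschitz_grad_def by blast
  from order_trans[OF norm_ge_zero this] show ?thesis by simp
qed

lemma blk_empty: "B j = {} \<Longrightarrow> blk U B j *v d = 0"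
  by (simp add: blk_def matrix_vector_mult_def vec_eq_iff)

text \<open>By \<open>block_descent\<close> the change of \<open>f\<close> is at most the linear
  term plus \<open>L j / 2 * (norm d)\<^sup>2\<close>; optimality of \<open>d\<close> makes this
  bound plus the change of \<open>\<psi>\<close> nonpositive.\<close>

lemma cpg_step_descent:
  fixes f \<psi> :: "real^'n \<Rightarrow> real"
  assumes diff: "\<And>y. f differentiable (at y)"
    and A1: "block_lipschitz_grad f U N B L" and j: "j \<in> {1..N}" and eta: "\<eta> j > 0"
    and min: "is_arg_min (\<lambda>d. f x + (transpose (blk U B j) *v grad f x) \<bullet> d
        + H_cpg \<psi> U N B L \<eta> j / 2 * (norm d)\<^sup>2 + \<psi> (x + blk U B j *v d))
        (\<lambda>d. d \<in> block_space B j) d"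
  shows "f (x + blk U B j *v d) + \<psi> (x + blk U B j *v d) \<le> f x + \<psi> x"
proof (cases "B j = {}")
  case True
  then show ?thesis by (simp add: blk_empty)
next
  case False
  define l where "l = (transpose (blk U B j) *v grad f x) \<bullet> d"
  define P where "P = (\<lambda>d. \<psi> (x + blk U B j *v d))"
  define H where "H = H_cpg \<psi> U N B L \<eta> j"
  define n where "n = (norm d)\<^sup>2"
  have L: "0 \<le> L j" by (rule block_lipschitz_nonneg[OF A1 j False])
  have n: "0 \<le> n" by (simp add: n_def)
  have d: "d \<in> block_space B j" using min by (simp add: is_arg_min_def)
  have desc: "f (x + blk U B j *v d) \<le> f x + l + L j / 2 * n"
    unfolding l_def n_def by (rule block_descent[OF diff A1 j d])
  \<comment> \<open>Multiples of the minimizer suffice as competitors: \<open>s = 0\<close> in the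
    case without convexity, \<open>s = 1 - t\<close> in the convex case.\<close>
  have opt: "l + H / 2 * n + P d \<le> s * l + H / 2 * (s\<^sup>2 * n) + P (s *\<^sub>R d)" for s
  proof -
    have "s *\<^sub>R d \<in> block_space B j" using d by (simp add: block_space_def)
    with min show ?thesis
      by (force simp: is_arg_min_def l_def P_def H_def n_def not_less power_mult_distrib)
  qed
  have "l + P d + L j / 2 * n \<le> P 0"
  proof (cases "\<forall>j\<in>{1..N}. \<forall>x. convex_on (block_space B j) (\<lambda>d. \<psi> (x + blk U B j *v d))")
    case False
    have "H = L j + \<eta> j" unfolding H_def H_cpg_def using False by (rule if_not_P)
    \<comment> \<open>Against the zero step, \<open>H / 2\<close> exceeds the required
      \<open>L j / 2\<close> by \<open>\<eta> j / 2\<close>.\<close>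
    with opt[of 0] eta n show ?thesis
      by (simp add: field_simps) (smt (verit) mult_nonneg_nonneg)
  next
    case True
    have H: "H = (L j + \<eta> j) / 2" unfolding H_def H_cpg_def using True by (rule if_P)
    have P: "convex_on (block_space B j) P" using True j unfolding P_def by blast
    txt \<open>The model is strongly convex: comparing its minimum with the value at \<open>(1 - t) d\<close> gains
      almost \<open>H \<parallel>d\<parallel>\<^sup>2\<close>, and this \<open>t\<close> is small enough for the gain to exceed \<open>L \<parallel>d\<parallel>\<^sup>2 / 2\<close>.\<close>
    define t where "t = \<eta> j / (L j + \<eta> j)"
    have t: "0 < t" "t \<le> 1" "t * (L j + \<eta> j) = \<eta> j"
      using L eta by (auto simp: t_def field_simps)
    have "P ((1 - t) *\<^sub>R d) \<le> (1 - t) * P d + t * P 0"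
      using convex_onD[OF P, of t d 0] t d by (simp add: block_space_def)
    with opt[of "1 - t"] have
      "l + H / 2 * n + P d \<le> (1 - t) * l + H / 2 * ((1 - t)\<^sup>2 * n) + ((1 - t) * P d + t * P 0)"
      by simp
    \<comment> \<open>Since \<open>1 - (1 - t)\<^sup>2 = t * (2 - t)\<close>, the whole difference
      carries a factor \<open>t\<close>, which is then cancelled.\<close>
    moreover have "t * (l + P d + (2 - t) * (H / 2) * n) - t * P 0 = (l + H / 2 * n + P d)
        - ((1 - t) * l + H / 2 * ((1 - t)\<^sup>2 * n) + ((1 - t) * P d + t * P 0))"
      by (simp add: field_simps power2_eq_square)
    ultimately have "t * (l + P d + (2 - t) * (H / 2) * n) \<le> t * P 0"
      by linarith
    then have "l + P d + (2 - t) * (H / 2) * n \<le> P 0"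
      using t by simp
    \<comment> \<open>The choice of \<open>t\<close> leaves a surplus of \<open>\<eta> j / 4\<close>
      over the required \<open>L j / 2\<close>.\<close>
    moreover have "(2 - t) * (H / 2) = L j / 2 + \<eta> j / 4"
      using t(3) unfolding H by (simp add: field_simps)
    ultimately show ?thesis
      using eta n by (smt (verit) mult_right_mono divide_nonneg_nonneg)
  qed
  with desc show ?thesis by (simp add: P_def)
qed

section \<open>Finitely many iterates of CGD\<close>

text \<open>For positive nondecreasing \<open>h\<close> the product \<open>s * h s\<close> is
  strictly increasing on the nonnegative reals. The root equations of the CGD rules have this
  shape.\<close>

lemma increasing_mult_inj:
  fixes h :: "real \<Rightarrow> real"
  assumes "\<alpha> \<ge> 0" "\<beta> \<ge> 0" "\<alpha> * h \<alpha> = \<beta> * h \<beta>"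
    and mono: "\<And>s t. 0 \<le> s \<Longrightarrow> s \<le> t \<Longrightarrow> h s \<le> h t" and pos: "\<And>s. 0 \<le> s \<Longrightarrow> 0 < h s"
  shows "\<alpha> = \<beta>"
proof -
  have "s * h s < t * h t" if "0 \<le> s" "s < t" for s t
    using that mono[of s t] pos[of s] by (smt (verit) mult_strict_right_mono mult_left_mono)
  from this[of \<alpha> \<beta>] this[of \<beta> \<alpha>] show ?thesis using assms(1-3) by linarith
qed

lemma mnorm_nonneg: "0 \<le> mnorm A"
  unfolding mnorm_def by (intro onorm_pos_le matrix_vector_mul_bounded_linear)

text \<open>In rules 1 to 3 the root equation is \<open>\<alpha> * h \<alpha> = g\<close>, where
  \<open>h \<alpha>\<close> is the very value given to \<open>HF\<close>. Positive \<open>Hf\<close>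
  makes \<open>h\<close> positive, so the root is unique.\<close>

lemma admissible_rule_unique:
  assumes rl: "admissible_rule \<psi> U N B x0 H\<psi> p L\<psi> rl" and Hf: "0 < Hf"
    and 1: "rl y Hf g HF" and 2: "rl y Hf g HF'"
  shows "HF = HF'"
proof -
  consider (r1) "0 < H\<psi>" "0 < L\<psi>" "rl = rule1 H\<psi> p L\<psi>" | (r2) "0 < H\<psi>" "rl = rule2 H\<psi> p"
    | (r3) "0 < L\<psi>" "rl = rule3 \<psi> x0 L\<psi>" | (r4) "rl = rule4"
    using rl unfolding admissible_rule_def block_hess_growth_def lipschitz_hess_def by blast
  then show ?thesis
  proof cases
    case r1
    define h where "h \<alpha> = H\<psi> / 2 * norm y ^ p + L\<psi> / 6 * \<alpha> + Hf" for \<alpha>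
    have eq: "L\<psi> / 6 * \<alpha>\<^sup>2 + (H\<psi> / 2 * norm y ^ p + Hf) * \<alpha> = \<alpha> * h \<alpha>" for \<alpha>
      by (simp add: h_def algebra_simps power2_eq_square)
    have "0 < h s" "s \<le> t \<Longrightarrow> h s \<le> h t" if "0 \<le> s" for s t
      using that r1 Hf by (auto simp: h_def intro!: add_nonneg_pos)
    then have inj: "\<alpha> = \<beta>" if "0 \<le> \<alpha>" "0 \<le> \<beta>" "\<alpha> * h \<alpha> = \<beta> * h \<beta>" for \<alpha> \<beta>
      using that by (intro increasing_mult_inj[of \<alpha> \<beta> h])
    obtain \<alpha> \<beta> where "0 \<le> \<alpha>" "\<alpha> * h \<alpha> = g" "HF = h \<alpha>" "0 \<le> \<beta>" "\<beta> * h \<beta> = g" "HF' = h \<beta>"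
      using 1 2 unfolding r1 rule1_def eq h_def[symmetric] by blast
    then show ?thesis using inj[of \<alpha> \<beta>] by simp
  next
    case r2
    define h where "h \<alpha> = 2 ^ (p - 1) * H\<psi> * norm y ^ p + 2 ^ (p - 1) * H\<psi> * \<alpha> ^ p + Hf" for \<alpha>
    have eq: "2 ^ (p - 1) * H\<psi> * \<alpha> ^ (p + 1) + (2 ^ (p - 1) * H\<psi> * norm y ^ p + Hf) * \<alpha>
        = \<alpha> * h \<alpha>" for \<alpha>
      by (simp add: h_def algebra_simps)
    have "0 < h s" "s \<le> t \<Longrightarrow> h s \<le> h t" if "0 \<le> s" for s t
      using that r2 Hf by (auto simp: h_def intro!: add_nonneg_pos mult_left_mono power_mono)
    then have inj: "\<alpha> = \<beta>" if "0 \<le> \<alpha>" "0 \<le> \<beta>" "\<alpha> * h \<alpha> = \<beta> * h \<beta>" for \<alpha> \<beta>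
      using that by (intro increasing_mult_inj[of \<alpha> \<beta> h])
    obtain \<alpha> \<beta> where "0 \<le> \<alpha>" "\<alpha> * h \<alpha> = g" "HF = h \<alpha>" "0 \<le> \<beta>" "\<beta> * h \<beta> = g" "HF' = h \<beta>"
      using 1 2 unfolding r2 rule2_def eq h_def[symmetric] by blast
    then show ?thesis using inj[of \<alpha> \<beta>] by simp
  next
    case r3
    define h where
      "h \<alpha> = L\<psi> / 2 * norm (y - x0) + 1 / 2 * mnorm (hess \<psi> x0) + L\<psi> / 6 * \<alpha> + Hf" for \<alpha>
    have eq: "L\<psi> / 6 * \<alpha>\<^sup>2 + (L\<psi> / 2 * norm (y - x0) + 1 / 2 * mnorm (hess \<psi> x0) + Hf) * \<alpha>
        = \<alpha> * h \<alpha>" for \<alpha>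
      by (simp add: h_def algebra_simps power2_eq_square)
    have "0 < h s" "s \<le> t \<Longrightarrow> h s \<le> h t" if "0 \<le> s" for s t
      using that r3 Hf mnorm_nonneg[of "hess \<psi> x0"]
      by (auto simp: h_def intro!: add_nonneg_pos add_nonneg_nonneg)
    then have inj: "\<alpha> = \<beta>" if "0 \<le> \<alpha>" "0 \<le> \<beta>" "\<alpha> * h \<alpha> = \<beta> * h \<beta>" for \<alpha> \<beta>
      using that by (intro increasing_mult_inj[of \<alpha> \<beta> h])
    obtain \<alpha> \<beta> where "0 \<le> \<alpha>" "\<alpha> * h \<alpha> = g" "HF = h \<alpha>" "0 \<le> \<beta>" "\<beta> * h \<beta> = g" "HF' = h \<beta>"
      using 1 2 unfolding r3 rule3_def eq h_def[symmetric] by blast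
    then show ?thesis using inj[of \<alpha> \<beta>] by simp
  next
    case r4
    then show ?thesis using 1 2 by (simp add: rule4_def)
  qed
qed

text \<open>Induction on \<open>k\<close>: finitely many states with finitely many successors per
  block have finitely many successors. The conjunct \<open>j \<in> J\<close> restricts the
  finiteness condition to actual blocks.\<close>

lemma finite_functional_orbit:
  assumes "\<And>\<omega>. \<omega> \<in> \<Omega> \<Longrightarrow> x 0 \<omega> = x0"
    and "\<And>k \<omega>. \<omega> \<in> \<Omega> \<Longrightarrow> \<exists>j\<in>J. T (x k \<omega>) j (x (Suc k) \<omega>)"
    and "finite J" and "\<And>y j. finite {z. j \<in> J \<and> T y j z}"
  shows "finite (x k ` \<Omega>)"
proof (induction k)
  case 0
  have "x 0 ` \<Omega> \<subseteq> {x0}" using assms(1) by auto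
  then show ?case using finite_subset by blast
next
  case (Suc k)
  have "x (Suc k) ` \<Omega> \<subseteq> (\<Union>y\<in>x k ` \<Omega>. \<Union>j\<in>J. {z. j \<in> J \<and> T y j z})"
    using assms(2) by blast
  moreover have "finite \<dots>" using Suc assms(3,4) by blast
  ultimately show ?case by (rule finite_subset)
qed

lemma cgd_finite_range:
  fixes F :: "real^'n \<Rightarrow> real"
  assumes A1: "block_lipschitz_grad f U N B L" and eta: "\<And>j. j \<in> {1..N} \<Longrightarrow> \<eta> j > 0"
    and rl: "admissible_rule \<psi> U N B x0 H\<psi> p L\<psi> rl"
    and run: "\<And>\<omega>. \<omega> \<in> \<Omega> \<Longrightarrow> cgd_run F U N B L \<eta> rl x0 (\<lambda>k. i k \<omega>) (\<lambda>k. x k \<omega>)"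
  shows "finite (x k ` \<Omega>)"
proof -
  define T where "T y j z \<longleftrightarrow> (\<exists>HF. rl y ((L j + \<eta> j) / 2)
        (norm (transpose (blk U B j) *v grad F y)) HF
      \<and> z = y + blk U B j *v (- (1 / HF) *\<^sub>R (transpose (blk U B j) *v grad F y)))" for y j z
  have unique: "z = z'" if j: "j \<in> {1..N}" and z: "T y j z" "T y j z'" for y j z z'
  proof (cases "B j = {}")
    case True
    then show ?thesis using z by (auto simp: T_def blk_empty)
  next
    case False
    have "0 < (L j + \<eta> j) / 2"
      using block_lipschitz_nonneg[OF A1 j False] eta[OF j] by simp
    from admissible_rule_unique[OF rl this] z show ?thesis
      unfolding T_def by metis
  qed
  have fin: "finite {z. j \<in> {1..N} \<and> T y j z}" for y j
  proof (cases "\<exists>z. j \<in> {1..N} \<and> T y j z")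
    case True
    then obtain z where "j \<in> {1..N}" "T y j z" by blast
    then have "{z. j \<in> {1..N} \<and> T y j z} \<subseteq> {z}" using unique by blast
    then show ?thesis using finite_subset by blast
  qed simp
  show ?thesis
  proof (rule finite_functional_orbit[where T = T and J = "{1..N}"])
    show "x 0 \<omega> = x0" if "\<omega> \<in> \<Omega>" for \<omega>
      using run[OF that] by (simp add: cgd_run_def)
    show "\<exists>j\<in>{1..N}. T (x k \<omega>) j (x (Suc k) \<omega>)" if "\<omega> \<in> \<Omega>" for k \<omega>
      using run[OF that] unfolding cgd_run_def T_def by blast
  qed (use fin in auto)
qed

section \<open>The rate\<close>

text \<open>Discrete form of \<open>\<delta>' \<le> - c * \<delta>\<^sup>2\<close>: the reciprocals
  of \<open>\<delta>\<close> grow by at least \<open>c\<close> per step. The product form also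
  covers vanishing \<open>\<delta>\<close>.\<close>

lemma quadratic_decrease_rate:
  fixes \<delta> :: "nat \<Rightarrow> real"
  assumes nonneg: "\<And>k. 0 \<le> \<delta> k" and c: "0 \<le> c"
    and step: "\<And>k. \<delta> (Suc k) \<le> \<delta> k - c * (\<delta> k)\<^sup>2"
  shows "\<delta> k * (1 + c * \<delta> 0 * real k) \<le> \<delta> 0"
proof (induction k)
  case (Suc k)
  define q where "q = 1 + c * \<delta> 0 * real k"
  have q: "0 < q" using c nonneg[of 0] by (simp add: q_def add_pos_nonneg)
  have le: "\<delta> (Suc k) \<le> \<delta> k"
    using step[of k] mult_nonneg_nonneg[OF c zero_le_power2[of "\<delta> k"]] by linarith
  have IH: "\<delta> k * q \<le> \<delta> 0" using Suc by (simp add: q_def)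
  show ?case
  proof (cases "\<delta> k = 0")
    case True
    then have "\<delta> (Suc k) = 0" using le nonneg[of "Suc k"] by simp
    then show ?thesis using nonneg by simp
  next
    case False
    then have pos: "0 < \<delta> k" using nonneg[of k] by simp
    \<comment> \<open>Weakening the square to a mixed product gives the reciprocal increment, still
      multiplied by \<open>\<delta> k * \<delta> (Suc k)\<close>.\<close>
    have "\<delta> k * \<delta> (Suc k) * c \<le> \<delta> k * \<delta> k * c"
      using le c nonneg[of k] by (intro mult_right_mono mult_left_mono) auto
    then have "\<delta> k * \<delta> (Suc k) * c \<le> \<delta> k - \<delta> (Suc k)"
      using step[of k] by (simp add: power2_eq_square mult_ac)
    then have "\<delta> 0 * (\<delta> k * \<delta> (Suc k) * c) \<le> \<delta> 0 * (\<delta> k - \<delta> (Suc k))"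
      using nonneg[of 0] by (intro mult_left_mono)
    moreover have "\<delta> (Suc k) * (\<delta> k * q) \<le> \<delta> (Suc k) * \<delta> 0"
      using IH nonneg[of "Suc k"] by (intro mult_left_mono)
    \<comment> \<open>On adding the two bounds the terms
      \<open>\<delta> 0 * \<delta> (Suc k)\<close> cancel, and a common factor
      \<open>\<delta> k\<close> remains.\<close>
    ultimately have "\<delta> k * (\<delta> (Suc k) * (q + c * \<delta> 0)) \<le> \<delta> k * \<delta> 0"
      by (simp add: algebra_simps)
    then have "\<delta> (Suc k) * (q + c * \<delta> 0) \<le> \<delta> 0" using pos by simp
    then show ?thesis by (simp add: q_def algebra_simps)
  qed
qed simp

theorem theorem7p1:
  fixes f \<psi> F :: "real^'n \<Rightarrow> real"
    and U :: "real^'n^'n" and N :: nat and B :: "nat \<Rightarrow> 'n set"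
    and L \<eta> :: "nat \<Rightarrow> real" and H\<psi> L\<psi> :: real and p :: nat
    and M :: "'w measure" and i :: "nat \<Rightarrow> 'w \<Rightarrow> nat" and x :: "nat \<Rightarrow> 'w \<Rightarrow> real^'n"
    and x0 :: "real^'n" and C R :: real
  assumes F_def: "F = (\<lambda>y. f y + \<psi> y)"
    and f_diff: "\<And>y. f differentiable (at y)"
    and U: "column_permutation U"
    and split: "block_split N B"
    and A1: "block_lipschitz_grad f U N B L"
    and A2: "twice_cont_diff \<psi>"
    and A3: "minimizers F \<noteq> {}"
    and eta: "\<And>j. j \<in> {1..N} \<Longrightarrow> \<eta> j > 0"
    and M: "prob_space M"
    and x_rv: "\<And>k. x k \<in> borel_measurable M"
    and i_choice: "uniform_block_choice M N i x"
    and algorithm: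
      "(\<forall>\<omega>\<in>space M. cpg_run f \<psi> U N B L \<eta> x0 (\<lambda>k. i k \<omega>) (\<lambda>k. x k \<omega>)) \<or>
       (\<exists>rl. admissible_rule \<psi> U N B x0 H\<psi> p L\<psi> rl \<and>
          (\<forall>\<omega>\<in>space M. cgd_run F U N B L \<eta> rl x0 (\<lambda>k. i k \<omega>) (\<lambda>k. x k \<omega>)))"
    and C_pos: "C > 0"
    and decrease:
      "\<And>k. AE \<omega> in M.
         F (x k \<omega>) - cond_exp_given M (\<lambda>\<omega>'. F (x (Suc k) \<omega>')) (x k) \<omega>
           \<ge> C * (norm (grad F (x k \<omega>)))\<^sup>2"
    and F_convex: "convex_on UNIV F"
    and R_finite:
      "bdd_above ((\<lambda>(k, \<omega>). infdist (x k \<omega>) (minimizers F)) ` (UNIV \<times> space M))"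
    and R_def: "R = (SUP (k, \<omega>) \<in> UNIV \<times> space M. infdist (x k \<omega>) (minimizers F))"
  shows "\<forall>k. \<forall>xs\<in>minimizers F.
           prob_space.expectation M (\<lambda>\<omega>. F (x k \<omega>) - F xs)
             \<le> (F x0 - F xs) * R\<^sup>2 / (C * (F x0 - F xs) * real k + R\<^sup>2)"
proof (intro allI ballI)
  fix k xs assume xs: "xs \<in> minimizers F"
  interpret prob_space M by (rule M)
  have F_diff: "F differentiable (at y)" for y
    using f_diff A2 unfolding F_def twice_cont_diff_def by (intro differentiable_add) auto
  have F_cont: "continuous_on UNIV F"
    using F_diff by (simp add: differentiable_at_imp_differentiable_on differentiable_imp_continuous_on)
  have F_meas: "(\<lambda>\<omega>. F (x k \<omega>)) \<in> borel_measurable M" for k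
    using borel_measurable_continuous_onI[OF F_cont] x_rv by measurable
  have min: "F xs \<le> F y" for y
    using xs by (force simp: minimizers_def is_arg_min_def not_less)
  \<comment> \<open>As a sublevel set of a continuous function the set of minimizers is closed, so
    distances to it are attained.\<close>
  have mins: "minimizers F = {y. F y \<le> F xs}"
    using order_trans[OF _ min] by (auto simp: minimizers_def is_arg_min_def not_less)
  have closed: "closed (minimizers F)"
    unfolding mins by (intro closed_Collect_le F_cont continuous_on_const)
  have x_0: "x 0 \<omega> = x0" if "\<omega> \<in> space M" for \<omega>
    using algorithm that by (auto simp: cpg_run_def cgd_run_def)
  \<comment> \<open>A bound for each fixed \<open>k\<close> is enough for integrability, the minimum
    being the lower bound; for CGD it may depend on \<open>k\<close>.\<close>
  have bounded: "\<exists>b. \<forall>\<omega>\<in>space M. F (x k \<omega>) \<le> b" for k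
    using algorithm
  proof
    assume run: "\<forall>\<omega>\<in>space M. cpg_run f \<psi> U N B L \<eta> x0 (\<lambda>k. i k \<omega>) (\<lambda>k. x k \<omega>)"
    have "F (x k \<omega>) \<le> F x0" if \<omega>: "\<omega> \<in> space M" for \<omega>
    proof (induction k)
      case 0
      then show ?case using x_0[OF \<omega>] by simp
    next
      case (Suc k)
      obtain d where i: "i k \<omega> \<in> {1..N}" and d: "is_arg_min
              (\<lambda>d. f (x k \<omega>) + (transpose (blk U B (i k \<omega>)) *v grad f (x k \<omega>)) \<bullet> d
                   + H_cpg \<psi> U N B L \<eta> (i k \<omega>) / 2 * (norm d)\<^sup>2
                   + \<psi> (x k \<omega> + blk U B (i k \<omega>) *v d))
              (\<lambda>d. d \<in> block_space B (i k \<omega>)) d"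
          and x: "x (Suc k) \<omega> = x k \<omega> + blk U B (i k \<omega>) *v d"
        using run \<omega> unfolding cpg_run_def by blast
      have "F (x (Suc k) \<omega>) \<le> F (x k \<omega>)"
        using cpg_step_descent[OF f_diff A1 i eta[OF i] d] by (simp add: F_def x)
      with Suc show ?case by simp
    qed
    then show ?thesis by blast
  next
    assume "\<exists>rl. admissible_rule \<psi> U N B x0 H\<psi> p L\<psi> rl \<and>
          (\<forall>\<omega>\<in>space M. cgd_run F U N B L \<eta> rl x0 (\<lambda>k. i k \<omega>) (\<lambda>k. x k \<omega>))"
    then obtain rl where rl: "admissible_rule \<psi> U N B x0 H\<psi> p L\<psi> rl"
      and run: "\<And>\<omega>. \<omega> \<in> space M \<Longrightarrow> cgd_run F U N B L \<eta> rl x0 (\<lambda>k. i k \<omega>) (\<lambda>k. x k \<omega>)"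
      by blast
    have "finite (x k ` space M)"
      by (rule cgd_finite_range[OF A1 _ rl run]) (simp_all add: eta)
    then have "bdd_above (F ` x k ` space M)"
      by (rule bdd_above_finite[OF finite_imageI])
    then show ?thesis unfolding bdd_above_def by blast
  qed
  define G where "G k \<omega> = F (x k \<omega>) - F xs" for k \<omega>
  define \<delta> where "\<delta> k = expectation (G k)" for k
  have G_nonneg: "0 \<le> G k \<omega>" for k \<omega> using min by (simp add: G_def)
  have G_int: "integrable M (G k)" "integrable M (\<lambda>\<omega>. (G k \<omega>)\<^sup>2)" for k
  proof -
    obtain b where b: "F (x k \<omega>) \<le> b" if "\<omega> \<in> space M" for \<omega> using bounded by blast
    have m: "G k \<in> borel_measurable M" unfolding G_def using F_meas by measurable
    show "integrable M (G k)"
      using b G_nonneg[of k] m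
      by (intro integrable_const_bound[where B = "b - F xs"]) (auto simp: G_def)
    show "integrable M (\<lambda>\<omega>. (G k \<omega>)\<^sup>2)"
      using b G_nonneg[of k] borel_measurable_power[OF m, of 2]
      by (intro integrable_const_bound[where B = "(b - F xs)\<^sup>2"])
        (auto simp: G_def intro!: power_mono)
  qed
  have F_int: "integrable M (\<lambda>\<omega>. F (x k \<omega>))" for k
  proof -
    have "integrable M (\<lambda>\<omega>. G k \<omega> + F xs)"
      by (intro Bochner_Integration.integrable_add G_int(1) integrable_const)
    then show ?thesis by (simp add: G_def)
  qed
  have dist: "infdist (x k \<omega>) (minimizers F) \<le> R" if "\<omega> \<in> space M" for k \<omega>
    unfolding R_def using that cSUP_upper[OF _ R_finite, of "(k, \<omega>)"] by simp
  have G_le: "G k \<omega> \<le> R * norm (grad F (x k \<omega>))" if \<omega>: "\<omega> \<in> space M" for k \<omega>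
  proof -
    \<comment> \<open>The nearest minimizer depends on the iterate, but it has the same value of
      \<open>F\<close> as \<open>xs\<close>, so the gap is unchanged.\<close>
    obtain y where y: "y \<in> minimizers F" "infdist (x k \<omega>) (minimizers F) = dist (x k \<omega>) y"
      using infdist_attains_inf[OF closed A3, of "x k \<omega>"] .
    have "G k \<omega> = F (x k \<omega>) - F y" using y(1) min[of y] by (simp add: G_def mins)
    also have "\<dots> \<le> grad F (x k \<omega>) \<bullet> (x k \<omega> - y)"
      by (rule convex_grad_ineq[OF F_convex F_diff])
    also have "\<dots> \<le> norm (grad F (x k \<omega>)) * norm (x k \<omega> - y)"
      by (rule norm_cauchy_schwarz)
    also have "\<dots> \<le> norm (grad F (x k \<omega>)) * R"
      using dist[OF \<omega>, of k] y(2) by (intro mult_left_mono) (auto simp: dist_norm)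
    finally show ?thesis by (simp add: mult.commute)
  qed
  have \<delta>_nonneg: "0 \<le> \<delta> k" for k
    unfolding \<delta>_def by (intro integral_nonneg_AE) (simp add: G_nonneg)
  have "expectation (G 0) = expectation (\<lambda>_. F x0 - F xs)"
    by (intro Bochner_Integration.integral_cong) (auto simp: G_def x_0)
  then have \<delta>_0: "\<delta> 0 = F x0 - F xs"
    by (simp add: \<delta>_def prob_space)
  show "expectation (\<lambda>\<omega>. F (x k \<omega>) - F xs)
      \<le> (F x0 - F xs) * R\<^sup>2 / (C * (F x0 - F xs) * real k + R\<^sup>2)"
  \<comment> \<open>For \<open>R = 0\<close> all iterates are minimizers and both sides are 0, even
    at \<open>k = 0\<close>, where the quotient is 0 / 0, which is 0 by convention. Otherwise
    \<open>C / R\<^sup>2\<close> makes sense.\<close>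
  proof (cases "R = 0")
    case True
    then have "G k \<omega> = 0" if "\<omega> \<in> space M" for \<omega>
      using G_le[OF that, of k] G_nonneg[of k \<omega>] by simp
    then have "expectation (G k) = expectation (\<lambda>_. 0)"
      by (intro Bochner_Integration.integral_cong) auto
    then show ?thesis using True by (simp add: G_def[abs_def])
  next
    case False
    define c where "c = C / R\<^sup>2"
    have c: "0 < c" using False C_pos by (simp add: c_def)
    have step: "\<delta> (Suc k) \<le> \<delta> k - c * (\<delta> k)\<^sup>2" for k
    proof -
      \<comment> \<open>Conditioning on the iterate means conditioning on the sigma-algebra it
        generates; being a subalgebra of a probability space, it admits conditional
        expectations.\<close>
      define S where "S = vimage_algebra (space M) (x k) borel"
      have "subalgebra M S"
        using x_rv[of k] by (simp add: subalgebra_def S_def measurable_iff_sets)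
      then interpret finite_measure_subalgebra M S by unfold_locales
      define E where "E = real_cond_exp M S (\<lambda>\<omega>. F (x (Suc k) \<omega>))"
      \<comment> \<open>The tower property: on taking expectations the conditional decrease becomes
        a decrease of \<open>\<delta>\<close>.\<close>
      have E: "integrable M E" "expectation E = expectation (\<lambda>\<omega>. F (x (Suc k) \<omega>))"
        unfolding E_def using real_cond_exp_int[OF F_int] by auto
      have "AE \<omega> in M. c * (G k \<omega>)\<^sup>2 \<le> F (x k \<omega>) - E \<omega>"
        using decrease[of k, unfolded cond_exp_given_def, folded S_def] AE_space
      proof eventually_elim
        case (elim \<omega>)
        have "(G k \<omega>)\<^sup>2 \<le> R\<^sup>2 * (norm (grad F (x k \<omega>)))\<^sup>2"
          using power_mono[OF G_le[OF elim(2), of k] G_nonneg, of 2]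
          by (simp add: power_mult_distrib)
        then have "c * (G k \<omega>)\<^sup>2 \<le> c * (R\<^sup>2 * (norm (grad F (x k \<omega>)))\<^sup>2)"
          using c by (intro mult_left_mono) auto
        also have "\<dots> = C * (norm (grad F (x k \<omega>)))\<^sup>2"
          using False by (simp add: c_def)
        finally show ?case using elim(1) by (simp add: E_def)
      qed
      then have "expectation (\<lambda>\<omega>. c * (G k \<omega>)\<^sup>2) \<le> expectation (\<lambda>\<omega>. F (x k \<omega>) - E \<omega>)"
        by (rule integral_mono_AE[rotated 2])
          (intro integrable_mult_right Bochner_Integration.integrable_diff G_int F_int E)+
      also have "\<dots> = expectation (\<lambda>\<omega>. F (x k \<omega>)) - expectation (\<lambda>\<omega>. F (x (Suc k) \<omega>))"
        by (simp only: Bochner_Integration.integral_diff[OF F_int E(1)] E(2))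
      also have "\<dots> = \<delta> k - \<delta> (Suc k)"
        unfolding \<delta>_def G_def
        by (simp add: Bochner_Integration.integral_diff[OF F_int integrable_const] prob_space)
      finally have "c * expectation (\<lambda>\<omega>. (G k \<omega>)\<^sup>2) \<le> \<delta> k - \<delta> (Suc k)" by simp
      \<comment> \<open>Jensen's inequality for the square, in the form that the variance is
        nonnegative.\<close>
      moreover have "(\<delta> k)\<^sup>2 \<le> expectation (\<lambda>\<omega>. (G k \<omega>)\<^sup>2)"
        using variance_positive[of "G k"] variance_eq[OF G_int] by (simp add: \<delta>_def)
      then have "c * (\<delta> k)\<^sup>2 \<le> c * expectation (\<lambda>\<omega>. (G k \<omega>)\<^sup>2)"
        using c by (intro mult_left_mono) auto
      ultimately show ?thesis by simp
    qed
    have pos: "0 < C * (F x0 - F xs) * real k + R\<^sup>2"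
      using False C_pos min[of x0] by (intro add_nonneg_pos) auto
    have "\<delta> k * (1 + c * \<delta> 0 * real k) \<le> \<delta> 0"
      by (rule quadratic_decrease_rate[OF _ less_imp_le[OF c]]) (rule \<delta>_nonneg step)+
    \<comment> \<open>Multiplying by \<open>R\<^sup>2\<close> turns \<open>c\<close> back into
      \<open>C\<close> and produces the denominator of the claim.\<close>
    then have "\<delta> k * (1 + c * \<delta> 0 * real k) * R\<^sup>2 \<le> \<delta> 0 * R\<^sup>2"
      by (intro mult_right_mono) auto
    moreover have "(1 + c * \<delta> 0 * real k) * R\<^sup>2 = C * (F x0 - F xs) * real k + R\<^sup>2"
      using False by (simp add: c_def \<delta>_0 distrib_right)
    ultimately have "\<delta> k * (C * (F x0 - F xs) * real k + R\<^sup>2) \<le> (F x0 - F xs) * R\<^sup>2"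
      by (simp only: \<delta>_0 mult.assoc)
    then have "\<delta> k \<le> (F x0 - F xs) * R\<^sup>2 / (C * (F x0 - F xs) * real k + R\<^sup>2)"
      by (simp only: pos_le_divide_eq[OF pos])
    then show ?thesis by (simp add: \<delta>_def G_def[abs_def])
  qed
qed

end
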